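(* Let $G$ be a simple, connected and finite non-planar graph. Then $\mathrm{girth}(G) \neq \mathrm{circum}(G)$.
   Context: For a graph $G$ containing at least one cycle, $\mathrm{girth}(G)$ is the length of a shortest cycle in $G$ and $\mathrm{circum}(G)$ (the circumference) is the length of a longest cycle in $G$. A graph is planar if it can be embedded in $\mathbb{R}^2$, and non-planar otherwise (a non-planar graph necessarily contains a cycle, so both invariants are defined). *)

theory Defs
  imports "HOL-Analysis.Analysis" "Graph_Theory.Graph_Theory"
begin

text \<open>A simple finite graph is represented by \<^locale>\<open>graph\<close>, a finite symmetric loop-free digraph
  without parallel arcs.  Each undirected edge is thus a pair of opposite arcs.\<close>

text \<open>The directed notion of cycle also accepts going back and forth along one edge; in a
  symmetric loop-free digraph without parallel arcs, the length bound excludes exactly these.\<close>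

definition graph_cycle :: "('a, 'b) pre_digraph \<Rightarrow> 'b awalk \<Rightarrow> bool" where
  "graph_cycle G p \<longleftrightarrow> pre_digraph.cycle G p \<and> 3 \<le> length p"

text \<open>Both invariants are only meaningful for finite graphs that contain a cycle.\<close>

definition girth :: "('a, 'b) pre_digraph \<Rightarrow> nat" where
  "girth G = Min {length p |p. graph_cycle G p}"

definition circum :: "('a, 'b) pre_digraph \<Rightarrow> nat" where
  "circum G = Max {length p |p. graph_cycle G p}"

definition uedges :: "('a, 'b) pre_digraph \<Rightarrow> 'a set set" where
  "uedges G = {{tail G a, head G a} |a. a \<in> arcs G}"

text \<open>An embedding of a simple graph in the plane: vertices are distinct points, each undirected
  edge is a Jordan arc joining its two end vertices and containing no other vertex, and two
  different edges meet only in common end vertices.\<close>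

definition plane_embedding ::
  "('a, 'b) pre_digraph \<Rightarrow> ('a \<Rightarrow> real ^ 2) \<Rightarrow> ('a set \<Rightarrow> real \<Rightarrow> real ^ 2) \<Rightarrow> bool" where
  "plane_embedding G \<phi> \<gamma> \<longleftrightarrow>
     inj_on \<phi> (verts G) \<and>
     (\<forall>e \<in> uedges G. arc (\<gamma> e) \<and> {pathstart (\<gamma> e), pathfinish (\<gamma> e)} = \<phi> ` e \<and>
        path_image (\<gamma> e) \<inter> \<phi> ` verts G = \<phi> ` e) \<and>
     (\<forall>e \<in> uedges G. \<forall>f \<in> uedges G. e \<noteq> f \<longrightarrow>
        path_image (\<gamma> e) \<inter> path_image (\<gamma> f) = \<phi> ` (e \<inter> f))"

definition planar :: "('a, 'b) pre_digraph \<Rightarrow> bool" where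
  "planar G \<longleftrightarrow> (\<exists>\<phi> \<gamma>. plane_embedding G \<phi> \<gamma>)"

end

theory Submission
  imports Defs
begin

text \<open>Suppose girth and circumference agree, so that all cycles have the same length, and give every
  edge weight 1.  Deleting a vertex of degree two and joining its two neighbours by an edge
  carrying the weight of the deleted path (unless they are adjacent already) keeps all cycle
  weights equal.  A nonempty positively weighted simple graph whose cycles all have the same
  weight has a vertex of degree at most two; therefore \<open>G\<close> can be dismantled by such
  eliminations, i.e. it is a subgraph of a 2-tree.  A 2-tree has a straight-line drawing: the
  new vertex of a triangle is placed near the midpoint of the edge it is attached to.\<close>

section \<open>Weighted cycles\<close>

text \<open>Bare edge sets replace the digraph from here on, because the elimination below adds
  edges that have no arcs. The empty list and all singletons count as paths, whatever the vertex set
  is.\<close>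

definition edge_path :: "'a set set \<Rightarrow> 'a list \<Rightarrow> bool" where
  "edge_path E xs \<longleftrightarrow> distinct xs \<and> successively (\<lambda>x y. {x, y} \<in> E) xs"

fun path_weight :: "('a set \<Rightarrow> real) \<Rightarrow> 'a list \<Rightarrow> real" where
  "path_weight w (x # y # xs) = w {x, y} + path_weight w (y # xs)"
| "path_weight w xs = 0"

text \<open>The first vertex is not repeated at the end, so the length of the list is the number of
  edges of the cycle.\<close>

definition edge_cycle :: "'a set set \<Rightarrow> 'a list \<Rightarrow> bool" where
  "edge_cycle E xs \<longleftrightarrow> edge_path E xs \<and> 3 \<le> length xs \<and> {last xs, hd xs} \<in> E"

definition cycle_weight :: "('a set \<Rightarrow> real) \<Rightarrow> 'a list \<Rightarrow> real" where
  "cycle_weight w xs = path_weight w xs + w {last xs, hd xs}"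

definition equicyclic :: "'a set set \<Rightarrow> ('a set \<Rightarrow> real) \<Rightarrow> real \<Rightarrow> bool" where
  "equicyclic E w L \<longleftrightarrow> (\<forall>xs. edge_cycle E xs \<longrightarrow> cycle_weight w xs = L)"

definition simple_edges :: "'a set \<Rightarrow> 'a set set \<Rightarrow> bool" where
  "simple_edges V E \<longleftrightarrow> (\<forall>e\<in>E. e \<subseteq> V \<and> card e = 2)"

lemma simple_edgesD:
  assumes "simple_edges V E" "{x, y} \<in> E"
  shows "x \<in> V" "y \<in> V" "x \<noteq> y"
  using assms unfolding simple_edges_def by fastforce+

lemma path_weight_append:
  assumes "xs \<noteq> []" "ys \<noteq> []"
  shows "path_weight w (xs @ ys) = path_weight w xs + w {last xs, hd ys} + path_weight w ys"
  using assms
proof (induction w xs rule: path_weight.induct)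
  case ("2_2" w x)
  then show ?case by (cases ys) auto
qed auto

lemma path_weight_rev: "path_weight w (rev xs) = path_weight w xs"
proof (induction w xs rule: path_weight.induct)
  case (1 w x y xs)
  have "path_weight w (rev (x # y # xs)) = path_weight w (rev (y # xs) @ [x])"
    by simp
  also have "\<dots> = path_weight w (rev (y # xs)) + w {y, x}"
    by (subst path_weight_append) auto
  finally show ?case using 1 by (simp add: insert_commute)
qed auto

lemma path_weight_nonneg:
  assumes "successively (\<lambda>x y. {x, y} \<in> E) xs" "\<And>e. e \<in> E \<Longrightarrow> 0 < w e"
  shows "0 \<le> path_weight w xs"
  using assms
  by (induction w xs rule: path_weight.induct) (auto intro: add_nonneg_nonneg less_imp_le)

lemma path_weight_pos:
  assumes "successively (\<lambda>x y. {x, y} \<in> E) xs" "\<And>e. e \<in> E \<Longrightarrow> 0 < w e" "2 \<le> length xs"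
  shows "0 < path_weight w xs"
proof -
  obtain x y zs where xs: "xs = x # y # zs"
    using assms(3) by (cases xs; cases "tl xs") auto
  have "0 \<le> path_weight w (y # zs)"
    by (rule path_weight_nonneg[of E]) (use assms xs in auto)
  then show ?thesis using assms xs by (auto intro: add_pos_nonneg)
qed

lemma path_weight_cong:
  assumes "successively (\<lambda>x y. {x, y} \<in> E) xs" "\<And>e. e \<in> E \<Longrightarrow> w e = w' e"
  shows "path_weight w xs = path_weight w' xs"
  using assms by (induction w xs rule: path_weight.induct) auto

lemma equicyclic_mono: "equicyclic E w L \<Longrightarrow> F \<subseteq> E \<Longrightarrow> equicyclic F w L"
  unfolding equicyclic_def edge_cycle_def edge_path_def
  by (metis (mono_tags, lifting) subsetD successively_mono)

text \<open>Serves to turn any chosen edge of a cycle into its closing edge.\<close>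

lemma edge_cycle_rotate:
  assumes "edge_cycle E (xs @ ys)" "xs \<noteq> []" "ys \<noteq> []"
  shows "edge_cycle E (ys @ xs)" "cycle_weight w (ys @ xs) = cycle_weight w (xs @ ys)"
  using assms
  by (auto simp: edge_cycle_def edge_path_def cycle_weight_def path_weight_append successively_append_iff)

section \<open>A vertex of degree at most two\<close>

text \<open>Two chords from the same end of a path close up three cycles, whose weights are compared.\<close>

lemma path_weight_two_chords:
  assumes ec: "equicyclic E w L" and path: "edge_path E (x # ys @ p # zs @ q # rs)"
    and "ys \<noteq> []" and p: "{x, p} \<in> E" and q: "{x, q} \<in> E"
  shows "path_weight w (x # ys @ [p]) = L / 2" "w {x, p} = L / 2"
proof -
  have len: "Suc 0 \<le> length ys" using \<open>ys \<noteq> []\<close> by (cases ys) auto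
  have "edge_cycle E (x # ys @ [p])" "edge_cycle E (x # p # zs @ [q])"
       "edge_cycle E ((x # ys) @ (p # zs @ [q]))"
    using path p q len \<open>ys \<noteq> []\<close>
    by (auto simp: edge_cycle_def edge_path_def successively_append_iff successively_Cons hd_append
        insert_commute)
  then have c: "cycle_weight w (x # ys @ [p]) = L" "cycle_weight w (x # p # zs @ [q]) = L"
      "cycle_weight w ((x # ys) @ (p # zs @ [q])) = L"
    using ec unfolding equicyclic_def by auto
  \<comment> \<open>The second and third cycles share the way from \<open>p\<close> through
    \<open>zs\<close> to \<open>q\<close> and back to \<open>x\<close>; hence
    \<open>x # ys @ [p]\<close> weighs as much as \<open>{x, p}\<close>, and by the first cycle the
    two add up to \<open>L\<close>.\<close>
  have "path_weight w ((x # ys) @ (p # zs @ [q]))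
      = path_weight w ((x # ys) @ [p]) + path_weight w (p # zs @ [q])"
    by (subst (1 2) path_weight_append) auto
  with c show "path_weight w (x # ys @ [p]) = L / 2" "w {x, p} = L / 2"
    by (auto simp: cycle_weight_def insert_commute)
qed

text \<open>A neighbour of \<open>x\<close> off the path would extend it, so all of them lie on
  \<open>xs\<close>. One may be the successor of \<open>x\<close>, which is the head of
  \<open>ys\<close>; at least two more remain, and \<open>p\<close> is the first of these.\<close>

lemma longest_path_first_chord:
  assumes E: "simple_edges V E" and path: "edge_path E (x # xs)"
    and longest: "\<And>ys. edge_path E ys \<Longrightarrow> length ys \<le> length (x # xs)"
    and deg: "2 < card {u. {x, u} \<in> E}"
  obtains ys p zs q rs where "xs = ys @ p # zs @ q # rs" "ys \<noteq> []" "{x, p} \<in> E" "{x, q} \<in> E"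
    "\<forall>u\<in>set (tl ys). {x, u} \<notin> E"
proof -
  define N where "N = {u. {x, u} \<in> E}"
  have N: "N \<subseteq> set xs"
  proof
    fix u assume "u \<in> N"
    then have u: "{x, u} \<in> E" by (simp add: N_def)
    show "u \<in> set xs"
    proof (rule ccontr)
      assume "u \<notin> set xs"
      then have "edge_path E (u # x # xs)"
        using path u simple_edgesD[OF E u] by (auto simp: edge_path_def insert_commute)
      from longest[OF this] show False by simp
    qed
  qed
  have card: "2 < card N" using deg by (simp add: N_def)
  \<comment> \<open>Applied to the successor \<open>n\<close> alone this yields \<open>p\<close>,
    applied to \<open>n\<close> and \<open>p\<close> it yields \<open>q\<close>.\<close>
  have small: "\<not> N \<subseteq> {c, d}" for c d
    using card card_mono[of "{c, d}" N] by (auto simp: card_insert_if split: if_splits)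
  obtain n t where xs: "xs = n # t" using N card by (cases xs) auto
  have "\<exists>u\<in>set t. {x, u} \<in> E"
    using small[of n n] N xs by (auto simp: N_def)
  then obtain ys p t' where t: "t = ys @ p # t'" "{x, p} \<in> E" "\<forall>u\<in>set ys. {x, u} \<notin> E"
    using split_list_first_prop[of t "\<lambda>u. {x, u} \<in> E"] by blast
  have "\<exists>u\<in>set t'. {x, u} \<in> E"
    using small[of n p] N xs t by (auto simp: N_def)
  then obtain q zs rs where "t' = zs @ q # rs" "{x, q} \<in> E"
    by (metis split_list)
  then show ?thesis using that[of "n # ys" p zs q rs] xs t by auto
qed

text \<open>Let \<open>p\<close> be the first chord end seen from the end \<open>x\<close> of a longest path.  Reversing the
  initial segment before \<open>p\<close> gives another longest path, whose first chord ends at \<open>p\<close> or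
  earlier.  Both chords cut off weight \<open>L / 2\<close> and have weight \<open>L / 2\<close> themselves, which
  leaves no room for the second one.\<close>

lemma equicyclic_low_degree:
  assumes "finite V" "V \<noteq> {}" and E: "simple_edges V E"
    and pos: "\<And>e. e \<in> E \<Longrightarrow> 0 < w e" and ec: "equicyclic E w L"
  shows "\<exists>v\<in>V. card {u. {v, u} \<in> E} \<le> 2"
proof (rule ccontr)
  assume "\<not> ?thesis"
  then have deg: "2 < card {u. {v, u} \<in> E}" if "v \<in> V" for v
    using that by force
  obtain v where v: "v \<in> V" using \<open>V \<noteq> {}\<close> by auto
  let ?P = "\<lambda>xs. edge_path E xs \<and> set xs \<subseteq> V"
  have "length xs \<le> card V" if "?P xs" for xs
    using that \<open>finite V\<close> by (metis card_mono distinct_card edge_path_def)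
  then have bound: "\<forall>xs. ?P xs \<longrightarrow> length xs < Suc (card V)"
    by (auto simp: less_Suc_eq_le)
  have "?P [v]" using v by (auto simp: edge_path_def)
  from ex_has_greatest_nat[of ?P, OF this bound]
  obtain xs0 where xs0: "?P xs0" and max: "\<And>ys. ?P ys \<Longrightarrow> length ys \<le> length xs0" by blast
  have "length [v] \<le> length xs0" using max \<open>?P [v]\<close> by blast
  then obtain x xs where xs: "xs0 = x # xs" by (cases xs0) auto
  have inV: "set ys \<subseteq> V" if "edge_path E ys" "2 \<le> length ys" for ys
  proof
    fix u assume "u \<in> set ys"
    then obtain as bs where ys: "ys = as @ u # bs" by (metis split_list)
    show "u \<in> V"
    proof (cases bs)
      case (Cons b bs')
      then have "{u, b} \<in> E" using that ys by (auto simp: edge_path_def successively_append_iff)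
      then show ?thesis using simple_edgesD[OF E] by blast
    next
      case Nil
      then have "as \<noteq> []" using that ys by auto
      then have "{last as, u} \<in> E"
        using that ys by (auto simp: edge_path_def successively_append_iff)
      then show ?thesis using simple_edgesD[OF E] by blast
    qed
  qed
  have longest: "length ys \<le> length (x # xs)" if "edge_path E ys" for ys
    using max[of ys] inV[of ys] that xs by (cases "2 \<le> length ys") auto
  have path: "edge_path E (x # xs)" using xs0 xs by auto
  have "2 < card {u. {x, u} \<in> E}" using deg xs0 xs by auto
  from longest_path_first_chord[OF E path longest this]
  obtain ys p zs q rs where dec: "xs = ys @ p # zs @ q # rs" "ys \<noteq> []" "{x, p} \<in> E" "{x, q} \<in> E"
    by metis
  have W: "path_weight w (x # ys @ [p]) = L / 2"
    using path_weight_two_chords[OF ec] path dec by metis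
  define R where "R = zs @ q # rs"
  obtain y ts where rev: "rev (x # ys) = y # ts" and y: "last ys = y"
    using dec(2) by (cases "rev (x # ys)"; cases ys rule: rev_cases) auto
  have "ts \<noteq> []" using rev dec(2) by (metis length_rev length_Cons list.size(3) length_0_conv nat.inject)
  \<comment> \<open>The reversed segment leads from \<open>y\<close>, the last vertex before
    \<open>p\<close>, back to \<open>x\<close>; the chord \<open>{x, p}\<close> joins it to the
    unchanged rest.\<close>
  have path': "edge_path E (y # ts @ p # R)"
  proof -
    have "edge_path E (rev (x # ys) @ p # R)"
      using path dec
      by (auto simp: edge_path_def R_def successively_append_iff successively_Cons insert_commute
          last_rev hd_rev)
    then show ?thesis by (simp only: rev append_Cons)
  qed
  \<comment> \<open>An edge of the old path that is a chord of the new one, as \<open>ts\<close> is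
    nonempty. So the first chord end seen from \<open>y\<close> cannot come after
    \<open>p\<close>.\<close>
  have yp: "{y, p} \<in> E"
    using path dec y by (auto simp: edge_path_def successively_append_iff successively_Cons)
  have len: "length (x # xs) = length (y # ts @ p # R)"
    using dec rev R_def by (metis append_Cons length_append length_rev)
  have "y \<in> V" using simple_edgesD[OF E yp] by auto
  from longest_path_first_chord[OF E path' _ deg[OF this]] longest len
  obtain ys' p' zs' q' rs' where dec': "ts @ p # R = ys' @ p' # zs' @ q' # rs'" "ys' \<noteq> []"
    "{y, p'} \<in> E" "{y, q'} \<in> E" "\<forall>u\<in>set (tl ys'). {y, u} \<notin> E"
    by metis
  have W': "path_weight w (y # ys' @ [p']) = L / 2" "w {y, p'} = L / 2"
    using path_weight_two_chords[OF ec] path' dec' by metis+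
  have "path_weight w (rev (x # ys)) = path_weight w (x # ys)"
    by (rule path_weight_rev)
  then have Wts: "path_weight w (y # ts) = path_weight w (x # ys)"
    using rev by simp
  have split: "path_weight w (x # ys @ [p]) = path_weight w (x # ys) + w {y, p}"
    using path_weight_append[of "x # ys" "[p]" w] dec(2) y by simp
  have pos1: "0 < path_weight w (x # ys)"
    by (rule path_weight_pos[of E])
       (use path dec pos in \<open>auto simp: edge_path_def successively_append_iff successively_Cons Suc_le_eq\<close>)
  \<comment> \<open>The weight \<open>L / 2\<close> of the way from \<open>x\<close> to
    \<open>p\<close> includes the positive weight of its last edge \<open>{y, p}\<close>.\<close>
  have Wlt: "path_weight w (y # ts) < L / 2"
    using split W pos[OF yp] Wts by linarith
  \<comment> \<open>In the first case \<open>p'\<close> comes at or before \<open>p\<close> on the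
    new path, in the second at or after it.\<close>
  consider us where "ts = ys' @ us" "us @ p # R = p' # zs' @ q' # rs'"
    | us where "ts @ us = ys'" "p # R = us @ p' # zs' @ q' # rs'"
    using dec'(1) by (auto simp: append_eq_append_conv2)
  then show False
  proof cases
    case 1
    show False
    proof (cases us)
      case Nil
      then have "p' = p" using 1 by simp
      \<comment> \<open>Now \<open>{y, p}\<close> alone would weigh \<open>L / 2\<close>, leaving
        nothing for the way from \<open>x\<close> to \<open>y\<close>.\<close>
      then show False using W'(2) split W pos1 by simp
    next
      case (Cons c us')
      then have "ts = ys' @ p' # us'" using 1 by simp
      then have ts: "y # ts = (y # ys' @ [p']) @ us'" by simp
      \<comment> \<open>The way from \<open>y\<close> to \<open>p'\<close> weighs
        \<open>L / 2\<close> but is an initial part of \<open>y # ts\<close>, which weighs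
        less.\<close>
      have "path_weight w (y # ys' @ [p']) \<le> path_weight w (y # ts)"
      proof (cases "us' = []")
        case True
        then show ?thesis using ts by simp
      next
        case False
        have s: "successively (\<lambda>x y. {x, y} \<in> E) ((y # ys' @ [p']) @ us')"
          using path' ts successively_append_iff[of _ "y # ts" "p # R"] by (simp add: edge_path_def)
        then have "0 \<le> path_weight w us'" "0 < w {last (y # ys' @ [p']), hd us'}"
          using False path_weight_nonneg[of E us' w] pos by (auto simp only: successively_append_iff)
        then show ?thesis
          using path_weight_append[of "y # ys' @ [p']" us' w] False ts by simp
      qed
      then show False using W' Wlt by linarith
    qed
  next
    case 2
    show False
    proof (cases us)
      case Nil
      then have "p' = p" using 2 by simp
      then show False using W'(2) split W pos1 by simp
    next
      case (Cons c us')
      then have "ys' = ts @ p # us'" using 2 by simp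
      \<comment> \<open>Since \<open>ts\<close> is nonempty, \<open>p\<close> is not the head of
        \<open>ys'\<close> and would be a chord end earlier than the first one.\<close>
      then have "p \<in> set (tl ys')" using \<open>ts \<noteq> []\<close> by (cases ts) auto
      then show False using dec'(5) yp by blast
    qed
  qed
qed

section \<open>Eliminating a vertex of degree two\<close>

lemma not_successivelyE:
  assumes "\<not> successively P xs"
  obtains ys x y zs where "xs = ys @ x # y # zs" "\<not> P x y"
  using assms
proof (induction P xs arbitrary: thesis rule: successively.induct)
  case (3 P x y xs)
  show ?case
  proof (cases "P x y")
    case True
    with 3 obtain ys u v zs where "y # xs = ys @ u # v # zs" "\<not> P u v"
      by (metis successively.simps(3))
    then show ?thesis using "3.prems"(1)[of "x # ys" u v zs] by simp
  next
    case False
    then show ?thesis using "3.prems"(1)[of "[]"] by simp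
  qed
qed auto

text \<open>In a cycle through the new edge, that edge can be replaced by the way from
  \<open>a\<close> over \<open>v\<close> to \<open>b\<close>, which has the same weight and meets
  the cycle nowhere else because all edges at \<open>v\<close> are gone. Every other cycle already
  lies in \<open>E\<close>.\<close>

lemma equicyclic_eliminate:
  assumes ec: "equicyclic E w L" and E: "simple_edges V E"
    and va: "{v, a} \<in> E" and vb: "{v, b} \<in> E" and ab: "a \<noteq> b" "{a, b} \<notin> E"
  shows "equicyclic (insert {a, b} {e \<in> E. v \<notin> e}) (w({a, b} := w {v, a} + w {v, b})) L"
    (is "equicyclic ?F ?w L")
  unfolding equicyclic_def
proof (intro allI impI)
  let ?K = "{e \<in> E. v \<notin> e}"
  have ne: "v \<noteq> a" "v \<noteq> b" using simple_edgesD[OF E] va vb by blast+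
  have w0: "?w e = w e" if "e \<in> ?K" for e using ab that by auto
  \<comment> \<open>First the new edge is taken to be the closing one; subdividing it then means
    appending \<open>v\<close> to the list.\<close>
  have closing: "cycle_weight ?w xs = L" if c: "edge_cycle ?F xs" and l: "{last xs, hd xs} = {a, b}" for xs
  proof -
    have d: "distinct xs" "3 \<le> length xs" using c by (auto simp: edge_cycle_def edge_path_def)
    \<comment> \<open>If the new edge also occurred between consecutive entries, these would be the
      first and the last entry, and a distinct list would have length two.\<close>
    have s: "successively (\<lambda>x y. {x, y} \<in> ?K) xs"
    proof (rule ccontr)
      assume "\<not> ?thesis"
      then obtain ys x y zs where xs: "xs = ys @ x # y # zs" "{x, y} \<notin> ?K"
        by (rule not_successivelyE)
      then have "{x, y} = {a, b}"
        using c by (auto simp: edge_cycle_def edge_path_def successively_append_iff)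
      then have "{x, y} = {last xs, hd xs}" using l by simp
      then show False using d xs
        by (cases ys; cases zs rule: rev_cases) (auto simp: doubleton_eq_iff)
    qed
    have "v \<notin> set xs"
    proof
      assume "v \<in> set xs"
      then obtain ys zs where xs: "xs = ys @ v # zs" by (metis split_list)
      then show False using s l ne d
        by (cases zs; cases ys rule: rev_cases) (auto simp: successively_append_iff doubleton_eq_iff)
    qed
    moreover have "successively (\<lambda>x y. {x, y} \<in> E) xs"
      using s by (rule successively_mono) auto
    moreover have lh: "last xs = a \<and> hd xs = b \<or> last xs = b \<and> hd xs = a"
      using l by (auto simp: doubleton_eq_iff)
    moreover have "xs \<noteq> []" using d by auto
    ultimately have "edge_cycle E (xs @ [v])"
      using d va vb by (auto simp: edge_cycle_def edge_path_def successively_append_iff insert_commute)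
    then have "cycle_weight w (xs @ [v]) = L" using ec by (simp add: equicyclic_def)
    moreover have "path_weight ?w xs = path_weight w xs"
      by (rule path_weight_cong[OF s w0])
    moreover have "cycle_weight w (xs @ [v]) = path_weight w xs + w {last xs, v} + w {v, hd xs}"
      using \<open>xs \<noteq> []\<close> by (simp add: cycle_weight_def path_weight_append)
    moreover have "w {last xs, v} = w {v, last xs}"
      by (simp add: insert_commute)
    then have "w {last xs, v} + w {v, hd xs} = w {v, a} + w {v, b}"
      using lh by auto
    ultimately show ?thesis using l by (simp add: cycle_weight_def)
  qed
  fix xs assume c: "edge_cycle ?F xs"
  show "cycle_weight ?w xs = L"
  proof (cases "successively (\<lambda>x y. {x, y} \<in> ?K) xs")
    case True
    show ?thesis
    proof (cases "{last xs, hd xs} = {a, b}")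
      case True
      show ?thesis by (rule closing[OF c True])
    next
      case False
      then have e: "{last xs, hd xs} \<in> ?K" using c by (auto simp: edge_cycle_def)
      have "successively (\<lambda>x y. {x, y} \<in> E) xs"
        using True by (rule successively_mono) auto
      then have "edge_cycle E xs" using c e by (auto simp: edge_cycle_def edge_path_def)
      then have "cycle_weight w xs = L" using ec by (simp add: equicyclic_def)
      then show ?thesis
        using path_weight_cong[OF True, of ?w w, OF w0] w0[OF e]
        unfolding cycle_weight_def by simp
    qed
  next
    case False
    then obtain ys x y zs where "xs = ys @ x # y # zs" and xy: "{x, y} \<notin> ?K"
      by (rule not_successivelyE)
    then have xs: "xs = (ys @ [x]) @ y # zs" by simp
    then have ab': "{x, y} = {a, b}"
      using c xy by (auto simp: edge_cycle_def edge_path_def successively_append_iff)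
    \<comment> \<open>Rotating the list between \<open>x\<close> and \<open>y\<close> makes the new
      edge the closing one.\<close>
    have c': "edge_cycle ?F ((ys @ [x]) @ y # zs)" using c xs by simp
    have "cycle_weight ?w ((y # zs) @ ys @ [x]) = L"
      by (rule closing) (use edge_cycle_rotate(1)[OF c'] ab' in auto)
    then show ?thesis
      using edge_cycle_rotate(2)[OF c', of ?w] xs by simp
  qed
qed

section \<open>Embedding into a 2-tree\<close>

text \<open>Starting from a single edge lets the induction on the number of vertices begin at
  two.\<close>

inductive two_tree :: "'a set \<Rightarrow> 'a set set \<Rightarrow> bool" where
  edge: "a \<noteq> b \<Longrightarrow> two_tree {a, b} {{a, b}}"
| triangle: "two_tree V E \<Longrightarrow> {a, b} \<in> E \<Longrightarrow> v \<notin> V \<Longrightarrow>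
    two_tree (insert v V) (insert {v, a} (insert {v, b} E))"

lemma two_tree_simple: "two_tree V E \<Longrightarrow> simple_edges V E"
proof (induction rule: two_tree.induct)
  case (triangle V E a b v)
  then have "a \<in> V" "b \<in> V" using simple_edgesD by metis+
  moreover from this triangle.hyps have "v \<noteq> a" "v \<noteq> b" by auto
  ultimately show ?case using triangle.IH by (simp add: simple_edges_def subset_insertI2)
qed (auto simp: simple_edges_def)

lemma two_tree_finite: "two_tree V E \<Longrightarrow> finite V \<and> finite E"
  by (induction rule: two_tree.induct) auto

text \<open>Supplies an edge to attach a triangle to when the eliminated vertex has at most one
  neighbour.\<close>

lemma two_tree_neighbour: "two_tree V E \<Longrightarrow> x \<in> V \<Longrightarrow> \<exists>y. {x, y} \<in> E"
  by (induction rule: two_tree.induct) (auto simp: insert_commute)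

text \<open>Induction on the number of vertices, removing a vertex \<open>v\<close> of degree at
  most two. The weights vary along the induction because an added edge inherits the weight of a
  path; \<open>L\<close> stays fixed.\<close>

lemma equicyclic_imp_sub_two_tree:
  assumes "2 \<le> card V" "simple_edges V E" "\<And>e. e \<in> E \<Longrightarrow> 0 < w e" "equicyclic E w L"
  shows "\<exists>F. E \<subseteq> F \<and> two_tree V F"
  using assms
proof (induction "card V" arbitrary: V E w)
  case 0
  then show ?case by simp
next
  case (Suc n)
  have fin: "finite V" using Suc.prems(1) by (metis card.infinite not_numeral_le_zero)
  show ?case
  proof (cases "card V = 2")
    case True
    then obtain a b where V: "V = {a, b}" "a \<noteq> b" by (auto simp: card_2_iff)
    have "e = V" if "e \<in> E" for e
      using that Suc.prems(2) True fin by (metis card_subset_eq simple_edges_def)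
    then have "E \<subseteq> {{a, b}}" using V by auto
    then show ?thesis using V two_tree.edge by metis
  next
    case False
    have "V \<noteq> {}" using Suc.prems(1) by auto
    from equicyclic_low_degree[OF fin this Suc.prems(2,3,4)]
    obtain v where v: "v \<in> V" and deg: "card {u. {v, u} \<in> E} \<le> 2" by auto
    define V' where "V' = V - {v}"
    define N where "N = {u. {v, u} \<in> E}"
    have V: "V = insert v V'" "v \<notin> V'" using v by (auto simp: V'_def)
    have card: "n = card V'" "2 \<le> card V'"
      using Suc.hyps(2) Suc.prems(1) False fin v by (auto simp: V'_def)
    have N: "N \<subseteq> V'"
      using simple_edgesD[OF Suc.prems(2), of v] unfolding N_def V'_def by blast
    define E0 where "E0 = {e \<in> E. v \<notin> e}"
    have E0: "simple_edges V' E0" "E0 \<subseteq> E"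
      using Suc.prems(2) by (auto simp: simple_edges_def E0_def V'_def)
    have E: "E \<subseteq> E0 \<union> (\<lambda>u. {v, u}) ` N"
    proof
      fix e assume e: "e \<in> E"
      have "card e = 2" using e Suc.prems(2) by (simp add: simple_edges_def)
      then obtain c d where cd: "e = {c, d}" by (auto simp: card_2_iff)
      show "e \<in> E0 \<union> (\<lambda>u. {v, u}) ` N"
        using e cd by (auto simp: E0_def N_def insert_commute)
    qed
    \<comment> \<open>Once some edge of the 2-tree on \<open>V'\<close> covers all neighbours of
      \<open>v\<close>, a triangle with tip \<open>v\<close> can be put on it.\<close>
    have "\<exists>F a b. two_tree V' F \<and> E0 \<subseteq> F \<and> {a, b} \<in> F \<and> N \<subseteq> {a, b}"
    proof (cases "card N = 2")
      case True
      then obtain a b where ab: "N = {a, b}" "a \<noteq> b" by (auto simp: card_2_iff)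
      have F: "simple_edges V' (insert {a, b} E0)"
        using E0 ab N by (auto simp: simple_edges_def)
      \<comment> \<open>Including \<open>{a, b}\<close> before the induction hypothesis is applied
        forces it into the 2-tree. The old weights do if it was an edge already; otherwise it takes
        over the weight of the path through \<open>v\<close>.\<close>
      have "\<exists>w'. (\<forall>e\<in>insert {a, b} E0. 0 < w' e) \<and> equicyclic (insert {a, b} E0) w' L"
      proof (cases "{a, b} \<in> E")
        case True
        then have "insert {a, b} E0 \<subseteq> E" using E0 by auto
        then show ?thesis using Suc.prems(3) equicyclic_mono[OF Suc.prems(4)]
          by (intro exI[of _ w]) auto
      next
        case False
        have va: "{v, a} \<in> E" and vb: "{v, b} \<in> E" using ab by (auto simp: N_def)
        have "equicyclic (insert {a, b} E0) (w({a, b} := w {v, a} + w {v, b})) L"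
          unfolding E0_def
          by (rule equicyclic_eliminate[OF Suc.prems(4,2) va vb ab(2) False])
        moreover have "0 < w {v, a} + w {v, b}"
          using Suc.prems(3)[OF va] Suc.prems(3)[OF vb] by linarith
        ultimately show ?thesis using Suc.prems(3) E0
          by (intro exI[of _ "w({a, b} := w {v, a} + w {v, b})"]) auto
      qed
      then obtain w' where "\<And>e. e \<in> insert {a, b} E0 \<Longrightarrow> 0 < w' e"
        "equicyclic (insert {a, b} E0) w' L" by blast
      from Suc.hyps(1)[OF card F this]
      show ?thesis using ab by blast
    next
      case False
      have "finite N" using N fin by (auto simp: V'_def intro: finite_subset)
      moreover have "card N < 2" using False deg by (simp add: N_def)
      moreover obtain c where c: "c \<in> V'" using card by fastforce
      \<comment> \<open>If \<open>v\<close> has no neighbour, the arbitrary vertex \<open>c\<close>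
        serves as \<open>a\<close>.\<close>
      ultimately obtain a where a: "a \<in> V'" "N \<subseteq> {a}"
        using N by (cases "N = {}") (auto simp: less_2_cases_iff card_1_singleton_iff)
      have "\<And>e. e \<in> E0 \<Longrightarrow> 0 < w e" using Suc.prems(3) E0 by auto
      from Suc.hyps(1)[OF card E0(1) this equicyclic_mono[OF Suc.prems(4) E0(2)]]
      obtain F where F: "E0 \<subseteq> F" "two_tree V' F" by blast
      moreover obtain b where "{a, b} \<in> F" using two_tree_neighbour[OF F(2) a(1)] by blast
      ultimately show ?thesis using a by blast
    qed
    then obtain F a b where F: "two_tree V' F" "E0 \<subseteq> F" "{a, b} \<in> F" "N \<subseteq> {a, b}" by blast
    have "two_tree V (insert {v, a} (insert {v, b} F))"
      using two_tree.triangle[OF F(1,3)] V by simp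
    moreover have "E \<subseteq> insert {v, a} (insert {v, b} F)"
      using E F by auto
    ultimately show ?thesis by blast
  qed
qed

section \<open>Straight-line drawings\<close>

text \<open>The hull of the two end points is the segment between them, so no direction of the edge
  has to be chosen. The inclusions opposite to those required hold automatically.\<close>

definition straight_drawing :: "'a set \<Rightarrow> 'a set set \<Rightarrow> ('a \<Rightarrow> real ^ 2) \<Rightarrow> bool" where
  "straight_drawing V E \<phi> \<longleftrightarrow> inj_on \<phi> V \<and>
     (\<forall>e\<in>E. \<forall>x\<in>V. \<phi> x \<in> convex hull (\<phi> ` e) \<longrightarrow> x \<in> e) \<and>
     (\<forall>e\<in>E. \<forall>f\<in>E. e \<noteq> f \<longrightarrow>
        convex hull (\<phi> ` e) \<inter> convex hull (\<phi> ` f) \<subseteq> \<phi> ` (e \<inter> f))"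

section \<open>Segments with one moving end\<close>

text \<open>The compact segment has a positive distance from \<open>K\<close>, and moving one end
  moves no point of the segment further than that end.\<close>

lemma eventually_closed_segment_disjoint:
  fixes M X :: "'b::euclidean_space"
  assumes "closed K" "closed_segment X M \<inter> K = {}"
  shows "\<forall>\<^sub>F p in nhds M. closed_segment X p \<inter> K = {}"
proof -
  obtain d where d: "0 < d" "\<And>x y. x \<in> closed_segment X M \<Longrightarrow> y \<in> K \<Longrightarrow> d \<le> dist x y"
    using separate_compact_closed[OF compact_segment assms(1,2)] by blast
  have "closed_segment X p \<inter> K = {}" if "dist p M < d" for p
  proof (rule ccontr)
    assume "closed_segment X p \<inter> K \<noteq> {}"
    then obtain u where u: "0 \<le> u" "u \<le> 1" "(1 - u) *\<^sub>R X + u *\<^sub>R p \<in> K"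
      by (auto simp: in_segment)
    have "dist ((1 - u) *\<^sub>R X + u *\<^sub>R M) ((1 - u) *\<^sub>R X + u *\<^sub>R p) = u * dist M p"
      using u by (simp add: dist_norm flip: scaleR_diff_right)
    also have "\<dots> \<le> dist M p" using u by (simp add: mult_left_le_one_le)
    also have "\<dots> < d" using that by (simp add: dist_commute)
    finally show False
      using d(2)[of "(1 - u) *\<^sub>R X + u *\<^sub>R M", OF _ u(3)] u by (force simp: in_segment)
  qed
  then show ?thesis using d(1) by (auto simp: eventually_nhds_metric)
qed

text \<open>Both \<open>p\<close> and \<open>D\<close> lie on the ray from \<open>A\<close> through
  \<open>X\<close>, and the nearer one lies on the segment to the other.\<close>

lemma closed_segments_common_end:
  fixes A :: "'b::euclidean_space"
  assumes "X \<in> closed_segment A p" "X \<in> closed_segment A D" "X \<noteq> A"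
  shows "p \<in> closed_segment A D \<or> D \<in> closed_segment A p"
proof -
  obtain s where s: "0 \<le> s" "s \<le> 1" "X = (1 - s) *\<^sub>R A + s *\<^sub>R p"
    using assms(1) by (auto simp: in_segment)
  obtain t where t: "0 \<le> t" "t \<le> 1" "X = (1 - t) *\<^sub>R A + t *\<^sub>R D"
    using assms(2) by (auto simp: in_segment)
  have st: "0 < s" "0 < t" using s t assms(3) by (auto simp: less_le)
  have eq: "s *\<^sub>R (p - A) = t *\<^sub>R (D - A)" using s t by (simp add: algebra_simps)
  have "p - A = (1 / s) *\<^sub>R (s *\<^sub>R (p - A))" "D - A = (1 / t) *\<^sub>R (t *\<^sub>R (D - A))"
    using st by auto
  then have pD: "p - A = (t / s) *\<^sub>R (D - A)" "D - A = (s / t) *\<^sub>R (p - A)"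
    using eq by auto
  show ?thesis
  proof (cases "t \<le> s")
    case True
    have "p = (1 - t / s) *\<^sub>R A + (t / s) *\<^sub>R D" using pD(1) by (simp add: algebra_simps)
    then show ?thesis using True st unfolding in_segment
      by (intro disjI1 exI[of _ "t / s"]) auto
  next
    case False
    have "D = (1 - s / t) *\<^sub>R A + (s / t) *\<^sub>R p" using pD(2) by (simp add: algebra_simps)
    then show ?thesis using False st unfolding in_segment
      by (intro disjI2 exI[of _ "s / t"]) auto
  qed
qed

lemma midpoint_halves:
  fixes A B :: "'b::euclidean_space"
  assumes "A \<noteq> B"
  shows "closed_segment A (midpoint A B) \<subseteq> closed_segment A B" "B \<notin> closed_segment A (midpoint A B)"
proof -
  show "closed_segment A (midpoint A B) \<subseteq> closed_segment A B"
    by (simp add: subset_closed_segment)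
  show "B \<notin> closed_segment A (midpoint A B)"
    using assms dist_in_closed_segment[of B A "midpoint A B"] dist_midpoint[of A B]
    by (auto simp: dist_commute)
qed

text \<open>The half of \<open>A B\<close> at \<open>A\<close> stays away from \<open>B\<close>, so
  a segment ending in \<open>B\<close> is no obstacle. If \<open>A\<close> is not an end of
  \<open>C D\<close>, the half misses \<open>C D\<close> and compactness applies; a shared end
  \<open>A\<close> needs a separate argument.\<close>

lemma eventually_closed_segment_meets_only_end:
  fixes A B C D :: "'b::euclidean_space"
  assumes AB: "A \<noteq> B" and ne: "{C, D} \<noteq> {A, B}" "C \<noteq> D"
    and meet: "closed_segment A B \<inter> closed_segment C D \<subseteq> {A, B} \<inter> {C, D}"
  shows "\<forall>\<^sub>F p in nhds (midpoint A B). closed_segment A p \<inter> closed_segment C D \<subseteq> {A} \<inter> {C, D}"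
proof -
  note mid = midpoint_halves[OF AB]
  \<comment> \<open>Apart from \<open>A\<close> the segments can only meet by overlapping along one
    ray. This is excluded if \<open>p\<close> is off \<open>A D\<close> and \<open>D\<close> is off
    \<open>A p\<close>, both of which persist near the midpoint.\<close>
  have common: "\<forall>\<^sub>F p in nhds (midpoint A B). closed_segment A p \<inter> closed_segment A D \<subseteq> {A}"
    if "D \<noteq> A" "D \<noteq> B" and m: "closed_segment A B \<inter> closed_segment A D \<subseteq> {A, B} \<inter> {A, D}" for D
  proof -
    have D: "D \<notin> closed_segment A B" using m that by auto
    have M: "midpoint A B \<notin> closed_segment A D"
    proof
      assume "midpoint A B \<in> closed_segment A D"
      then have "midpoint A B \<in> {A, B} \<inter> {A, D}" using m midpoint_in_closed_segment by blast
      then show False using that AB by auto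
    qed
    have "open (- closed_segment A D)" by (simp add: open_Compl)
    then have "\<forall>\<^sub>F p in nhds (midpoint A B). p \<in> - closed_segment A D"
      by (rule eventually_nhds_in_open) (use M in auto)
    moreover have "\<forall>\<^sub>F p in nhds (midpoint A B). closed_segment A p \<inter> {D} = {}"
      by (rule eventually_closed_segment_disjoint) (use D mid in auto)
    ultimately show ?thesis
      by eventually_elim (use closed_segments_common_end in blast)
  qed
  consider "A \<notin> {C, D}" | "A = C" | "A = D" by blast
  then show ?thesis
  proof cases
    case 1
    then have "closed_segment A (midpoint A B) \<inter> closed_segment C D = {}"
      using meet mid by blast
    from eventually_closed_segment_disjoint[OF closed_segment this]
    show ?thesis by eventually_elim auto
  next
    case 2
    then show ?thesis using common[of D] ne meet by auto
  next
    case 3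
    then show ?thesis using common[of C] ne meet
      by (auto simp: closed_segment_commute insert_commute)
  qed
qed

text \<open>A line has empty interior in the plane, so it contains no ball around
  \<open>M\<close>.\<close>

lemma exists_near_not_collinear:
  fixes M A B :: "real ^ 2"
  assumes "\<forall>\<^sub>F p in nhds M. P p" and AB: "A \<noteq> B"
  obtains p where "P p" "\<not> collinear {A, B, p}"
proof -
  obtain d where d: "0 < d" "\<And>p. dist p M < d \<Longrightarrow> P p"
    using assms by (auto simp: eventually_nhds_metric)
  have "interior (affine hull {A, B}) = {}"
    by (rule empty_interior_affine_hull) (auto simp: card_insert_if)
  then have "\<not> ball M d \<subseteq> affine hull {A, B}"
    using d(1) by (metis centre_in_ball empty_iff interior_maximal open_ball subsetD)
  then obtain p where "p \<in> ball M d" and p: "p \<notin> affine hull {A, B}" by blast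
  then have "dist p M < d" by (simp add: dist_commute)
  then show ?thesis using that[of p] d p AB collinear_3_affine_hull by blast
qed

lemma not_collinear_segments:
  fixes A B p :: "real ^ 2"
  assumes "\<not> collinear {A, B, p}"
  shows "closed_segment p A \<inter> closed_segment p B \<subseteq> {p}" "closed_segment p A \<inter> closed_segment A B \<subseteq> {A}"
proof -
  \<comment> \<open>A second common point would put \<open>Y\<close> and \<open>Z\<close> on one ray
    from \<open>X\<close>.\<close>
  have *: "closed_segment X Y \<inter> closed_segment X Z \<subseteq> {X}"
    if nc: "\<not> collinear {X, Y, Z}" for X Y Z :: "real ^ 2"
  proof
    fix u assume u: "u \<in> closed_segment X Y \<inter> closed_segment X Z"
    show "u \<in> {X}"
    proof (rule ccontr)
      assume "u \<notin> {X}"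
      with u have "Y \<in> closed_segment X Z \<or> Z \<in> closed_segment X Y"
        using closed_segments_common_end[of u X Y Z] by auto
      then show False using nc
        by (metis between_imp_collinear between_mem_segment insert_commute)
    qed
  qed
  show "closed_segment p A \<inter> closed_segment p B \<subseteq> {p}" "closed_segment p A \<inter> closed_segment A B \<subseteq> {A}"
    using *[of p A B] *[of A p B] assms by (auto simp: insert_commute closed_segment_commute)
qed

text \<open>Close to the midpoint of \<open>A B\<close>, the segments from the new point
  \<open>p\<close> to \<open>A\<close> and \<open>B\<close> avoid the same vertices and old edges as
  the two halves of \<open>A B\<close> do. Choosing \<open>p\<close> off the line \<open>A B\<close>
  separates them from that edge and from each other.\<close>

lemma straight_drawing_add_triangle:
  assumes \<phi>: "straight_drawing V E \<phi>" and fin: "finite V" "finite E" and E: "simple_edges V E"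
    and ab: "{a, b} \<in> E" and v: "v \<notin> V"
  shows "\<exists>\<psi>. straight_drawing (insert v V) (insert {v, a} (insert {v, b} E)) \<psi>"
proof -
  define A B where "A = \<phi> a" and "B = \<phi> b"
  note abV = simple_edgesD[OF E ab]
  have inj: "inj_on \<phi> V"
    and vert: "\<And>e x. e \<in> E \<Longrightarrow> x \<in> V \<Longrightarrow> \<phi> x \<in> convex hull (\<phi> ` e) \<Longrightarrow> x \<in> e"
    and cross: "\<And>e f. e \<in> E \<Longrightarrow> f \<in> E \<Longrightarrow> e \<noteq> f \<Longrightarrow>
        convex hull (\<phi> ` e) \<inter> convex hull (\<phi> ` f) \<subseteq> \<phi> ` (e \<inter> f)"
    using \<phi> by (auto simp: straight_drawing_def)
  have AB: "A \<noteq> B" using inj abV by (auto simp: A_def B_def inj_on_def)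
  have eV: "e \<subseteq> V" "v \<notin> e" if "e \<in> E" for e using that E v by (auto simp: simple_edges_def)
  have hull: "convex hull (\<phi> ` {x, y}) = closed_segment (\<phi> x) (\<phi> y)" for x y
    by (simp add: segment_convex_hull)
  have hull_ab: "convex hull (\<phi> ` {a, b}) = closed_segment A B"
    using hull by (simp add: A_def B_def)
  have edge: "\<forall>\<^sub>F p in nhds (midpoint A B).
      closed_segment A p \<inter> convex hull (\<phi> ` e) \<subseteq> \<phi> ` ({a} \<inter> e) \<and>
      closed_segment B p \<inter> convex hull (\<phi> ` e) \<subseteq> \<phi> ` ({b} \<inter> e)"
    if e: "e \<in> E - {{a, b}}" for e
  proof -
    have "card e = 2" using e E by (simp add: simple_edges_def)
    then obtain c d where cd: "e = {c, d}" "c \<noteq> d" by (auto simp: card_2_iff)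
    have cdV: "c \<in> V" "d \<in> V" using eV[of e] e cd by auto
    have ne: "{\<phi> c, \<phi> d} \<noteq> {A, B}" "\<phi> c \<noteq> \<phi> d"
      using e cd cdV abV inj unfolding A_def B_def
      by (auto simp: inj_on_eq_iff doubleton_eq_iff)
    have im: "\<phi> ` ({x} \<inter> e) = {\<phi> x} \<inter> {\<phi> c, \<phi> d}" if "x \<in> V" for x
      using that cd cdV inj by (auto simp: inj_on_eq_iff)
    have "closed_segment A B \<inter> closed_segment (\<phi> c) (\<phi> d) \<subseteq> \<phi> ` ({a, b} \<inter> e)"
      using cross[OF ab, of e] e unfolding cd(1) hull A_def B_def by blast
    also have "\<dots> \<subseteq> {A, B} \<inter> {\<phi> c, \<phi> d}" using cd by (auto simp: A_def B_def)
    finally have meet: "closed_segment A B \<inter> closed_segment (\<phi> c) (\<phi> d) \<subseteq> {A, B} \<inter> {\<phi> c, \<phi> d}" .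
    have "\<forall>\<^sub>F p in nhds (midpoint A B). closed_segment A p \<inter> closed_segment (\<phi> c) (\<phi> d) \<subseteq> {A} \<inter> {\<phi> c, \<phi> d}"
      by (rule eventually_closed_segment_meets_only_end[OF AB ne meet])
    moreover have "\<forall>\<^sub>F p in nhds (midpoint B A). closed_segment B p \<inter> closed_segment (\<phi> c) (\<phi> d) \<subseteq> {B} \<inter> {\<phi> c, \<phi> d}"
      by (rule eventually_closed_segment_meets_only_end)
        (use AB ne meet in \<open>auto simp: insert_commute closed_segment_commute\<close>)
    ultimately show ?thesis
      using im[OF abV(1)] im[OF abV(2)] hull[of c d] cd(1)
      by (intro eventually_conj) (simp_all add: A_def B_def midpoint_sym)
  qed
  have vertex: "\<forall>\<^sub>F p in nhds (midpoint A B).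
      closed_segment A p \<inter> {\<phi> x} = {} \<and> closed_segment B p \<inter> {\<phi> x} = {}"
    if x: "x \<in> V - {a, b}" for x
  proof -
    have "\<phi> x \<notin> closed_segment A B" using vert[OF ab, of x] x hull_ab by auto
    then have "closed_segment A (midpoint A B) \<inter> {\<phi> x} = {}"
      "closed_segment B (midpoint A B) \<inter> {\<phi> x} = {}"
      using midpoint_halves(1)[OF AB] midpoint_halves(1)[OF AB[symmetric]]
      by (auto simp: midpoint_sym closed_segment_commute)
    then show ?thesis
      by (intro eventually_conj eventually_closed_segment_disjoint) auto
  qed
  let ?P = "\<lambda>p. (\<forall>e\<in>E - {{a, b}}. closed_segment A p \<inter> convex hull (\<phi> ` e) \<subseteq> \<phi> ` ({a} \<inter> e) \<and>
        closed_segment B p \<inter> convex hull (\<phi> ` e) \<subseteq> \<phi> ` ({b} \<inter> e)) \<and>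
      (\<forall>x\<in>V - {a, b}. closed_segment A p \<inter> {\<phi> x} = {} \<and> closed_segment B p \<inter> {\<phi> x} = {})"
  \<comment> \<open>Finiteness of \<open>V\<close> and \<open>E\<close> allows all these conditions
    to hold in one neighbourhood.\<close>
  have "\<forall>\<^sub>F p in nhds (midpoint A B). ?P p"
    by (intro eventually_conj[OF eventually_ball_finite eventually_ball_finite] ballI edge vertex)
      (use fin in auto)
  from exists_near_not_collinear[OF this AB]
  obtain p where p: "?P p" and nc: "\<not> collinear {A, B, p}" by blast
  have nc': "\<not> collinear {B, A, p}" using nc by (simp add: insert_commute)
  have pab: "closed_segment p A \<inter> closed_segment p B \<subseteq> {p}"
    "closed_segment p A \<inter> closed_segment A B \<subseteq> {A}" "closed_segment p B \<inter> closed_segment A B \<subseteq> {B}"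
    using not_collinear_segments[OF nc] not_collinear_segments[OF nc']
    by (auto simp: closed_segment_commute)
  have pne: "p \<noteq> A" "p \<noteq> B" using nc by (auto simp: insert_commute)
  have new: "closed_segment p (\<phi> c) \<inter> convex hull (\<phi> ` e) \<subseteq> \<phi> ` ({c} \<inter> e)"
    if "e \<in> E" "c \<in> {a, b}" for e c
  proof (cases "e = {a, b}")
    case True
    then show ?thesis using pab that(2) hull_ab by (auto simp: A_def B_def)
  next
    case False
    then have "closed_segment A p \<inter> convex hull (\<phi> ` e) \<subseteq> \<phi> ` ({a} \<inter> e)"
      "closed_segment B p \<inter> convex hull (\<phi> ` e) \<subseteq> \<phi> ` ({b} \<inter> e)"
      using p that(1) by blast+
    then show ?thesis using that(2) by (auto simp: A_def B_def closed_segment_commute)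
  qed
  \<comment> \<open>Being on the new segment to \<open>A\<close>, the point \<open>p\<close> could
    lie on an old edge only by being \<open>A\<close>.\<close>
  have p_off: "p \<notin> convex hull (\<phi> ` e)" if "e \<in> E" for e
    using new[OF that, of a] pne by (auto simp: A_def)
  have newv: "x = c" if "x \<in> V" "c \<in> {a, b}" "\<phi> x \<in> closed_segment p (\<phi> c)" for x c
  proof (cases "x \<in> {a, b}")
    case True
    then have "\<phi> x \<in> closed_segment A B" by (auto simp: A_def B_def)
    then have "\<phi> x = \<phi> c" using that pab by (auto simp: A_def B_def)
    then show ?thesis using inj that abV by (auto simp: inj_on_eq_iff)
  next
    case False
    then show ?thesis using p that by (auto simp: A_def B_def closed_segment_commute)
  qed
  \<comment> \<open>The point \<open>p\<close> is on both new segments, so a vertex drawn there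
    would be \<open>a\<close> and \<open>b\<close> at once.\<close>
  have p_new: "p \<noteq> \<phi> x" if "x \<in> V" for x
    using newv[OF that, of a] newv[OF that, of b] abV(3) by auto
  define \<psi> where "\<psi> = \<phi>(v := p)"
  have \<psi>: "\<psi> v = p" "\<And>x. x \<in> V \<Longrightarrow> \<psi> x = \<phi> x" using v by (auto simp: \<psi>_def)
  have \<psi>E: "\<psi> ` e = \<phi> ` e" if "e \<in> E" for e using eV[OF that] \<psi>(2) by (intro image_cong) auto
  have \<psi>E': "\<psi> ` (s \<inter> e) = \<phi> ` (s \<inter> e)" if "e \<in> E" for e s
    using eV[OF that] \<psi>(2) by (intro image_cong) auto
  have hull_new: "convex hull (\<psi> ` {v, c}) = closed_segment p (\<phi> c)" if "c \<in> {a, b}" for c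
    using that abV \<psi> by (auto simp: segment_convex_hull)
  have new_old: "convex hull (\<psi> ` {v, c}) \<inter> convex hull (\<psi> ` e) \<subseteq> \<psi> ` ({v, c} \<inter> e)"
    if "e \<in> E" "c \<in> {a, b}" for e c
    using new[OF that] hull_new[OF that(2)] \<psi>E[OF that(1)] \<psi>E'[OF that(1), of "{c}"] by auto
  have new_new: "convex hull (\<psi> ` {v, a}) \<inter> convex hull (\<psi> ` {v, b}) \<subseteq> \<psi> ` ({v, a} \<inter> {v, b})"
    using pab(1) hull_new[of a] hull_new[of b] \<psi>(1) by (auto simp: A_def B_def)
  let ?E = "insert {v, a} (insert {v, b} E)"
  have "straight_drawing (insert v V) ?E \<psi>"
    unfolding straight_drawing_def
  proof (intro conjI ballI impI)
    show "inj_on \<psi> (insert v V)"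
    proof -
      have "inj_on \<psi> V" using inj \<psi>(2) inj_on_cong[of V \<psi> \<phi>] by blast
      moreover have "\<psi> v \<notin> \<psi> ` V" using p_new \<psi> by force
      ultimately show ?thesis using v by simp
    qed
  next
    fix e x assume e: "e \<in> ?E" and x: "x \<in> insert v V" and m: "\<psi> x \<in> convex hull (\<psi> ` e)"
    show "x \<in> e"
    proof (cases "e \<in> E")
      case True
      then show ?thesis using x m \<psi> \<psi>E[OF True] vert[OF True] p_off[OF True] by auto
    next
      case False
      then obtain c where c: "e = {v, c}" "c \<in> {a, b}" using e by auto
      then show ?thesis using x m \<psi> hull_new[OF c(2)] newv[OF _ c(2)] by auto
    qed
  next
    fix e f assume e: "e \<in> ?E" and f: "f \<in> ?E" and ne: "e \<noteq> f"
    consider "e \<in> E" "f \<in> E" | c where "e = {v, c}" "c \<in> {a, b}" "f \<in> E"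
      | c where "f = {v, c}" "c \<in> {a, b}" "e \<in> E" | "e = {v, a}" "f = {v, b}" | "e = {v, b}" "f = {v, a}"
      using e f ne by blast
    then show "convex hull (\<psi> ` e) \<inter> convex hull (\<psi> ` f) \<subseteq> \<psi> ` (e \<inter> f)"
    proof cases
      case 1
      then show ?thesis using cross[OF 1 ne] \<psi>E \<psi>E'[OF 1(2), of e] by simp
    next
      case 2
      then show ?thesis using new_old by blast
    next
      case 3
      then show ?thesis using new_old[OF 3(3,2)] by blast
    next
      case 4
      then show ?thesis using new_new by simp
    next
      case 5
      then show ?thesis using new_new by blast
    qed
  qed
  then show ?thesis by blast
qed

lemma two_tree_straight_drawing: "two_tree V E \<Longrightarrow> \<exists>\<phi>. straight_drawing V E \<phi>"
proof (induction rule: two_tree.induct)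
  case (edge a b)
  have "vec 0 \<noteq> (vec 1 :: real ^ 2)" by (simp add: vec_eq_iff)
  then obtain A B :: "real ^ 2" where "A \<noteq> B" by blast
  then have "straight_drawing {a, b} {{a, b}} (\<lambda>x. if x = a then A else B)"
    using edge by (auto simp: straight_drawing_def inj_on_def)
  then show ?case by blast
next
  case (triangle V E a b v)
  then show ?case
    using straight_drawing_add_triangle two_tree_simple two_tree_finite by metis
qed

section \<open>From straight-line drawings to plane embeddings\<close>

lemma (in graph) straight_drawing_imp_planar:
  assumes \<phi>: "straight_drawing (verts G) E \<phi>" and sub: "uedges G \<subseteq> E"
  shows "planar G"
proof -
  \<comment> \<open>An arc has a direction while an edge is a set, so an order of its two ends is
    chosen.\<close>
  define \<gamma> where "\<gamma> e = (let (a, b) = (SOME (a, b). e = {a, b}) in linepath (\<phi> a) (\<phi> b))" for e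
  have inj: "inj_on \<phi> (verts G)" using \<phi> by (simp add: straight_drawing_def)
  have ends: "\<exists>a b. e = {a, b} \<and> a \<noteq> b \<and> a \<in> verts G \<and> b \<in> verts G \<and> \<gamma> e = linepath (\<phi> a) (\<phi> b)"
    if e: "e \<in> uedges G" for e
  proof -
    obtain x where x: "x \<in> arcs G" "e = {tail G x, head G x}"
      using e by (auto simp: uedges_def)
    obtain a b where ab: "(SOME (a, b). e = {a, b}) = (a, b)" by fastforce
    have "case (SOME (a, b). e = {a, b}) of (a, b) \<Rightarrow> e = {a, b}"
      by (rule someI[of _ "(tail G x, head G x)"]) (use x in auto)
    then have eab: "e = {a, b}" using ab by simp
    have "a \<noteq> b" "a \<in> verts G" "b \<in> verts G"
      using x eab no_loops[OF x(1)] tail_in_verts[OF x(1)] head_in_verts[OF x(1)]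
      by (auto simp: doubleton_eq_iff)
    then show ?thesis using eab ab by (auto simp: \<gamma>_def)
  qed
  have image: "path_image (\<gamma> e) = convex hull (\<phi> ` e)" "\<phi> ` e \<subseteq> convex hull (\<phi> ` e)" "e \<subseteq> verts G"
    "Path_Connected.arc (\<gamma> e)" "{pathstart (\<gamma> e), pathfinish (\<gamma> e)} = \<phi> ` e"
    if e: "e \<in> uedges G" for e
    using ends[OF e] inj by (auto simp: segment_convex_hull inj_on_eq_iff hull_inc)
  have "plane_embedding G \<phi> \<gamma>"
    unfolding plane_embedding_def
  proof (intro conjI ballI impI)
    fix e assume e: "e \<in> uedges G"
    show "path_image (\<gamma> e) \<inter> \<phi> ` verts G = \<phi> ` e"
      using \<phi> e sub image[OF e] by (auto simp: straight_drawing_def)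
  next
    fix e f assume e: "e \<in> uedges G" and f: "f \<in> uedges G" and "e \<noteq> f"
    then have "path_image (\<gamma> e) \<inter> path_image (\<gamma> f) \<subseteq> \<phi> ` (e \<inter> f)"
      using \<phi> sub image(1)[OF e] image(1)[OF f] unfolding straight_drawing_def
      by (metis subsetD)
    moreover have "\<phi> ` (e \<inter> f) \<subseteq> path_image (\<gamma> e) \<inter> path_image (\<gamma> f)"
      using image(1,2)[OF e] image(1,2)[OF f] by auto
    ultimately show "path_image (\<gamma> e) \<inter> path_image (\<gamma> f) = \<phi> ` (e \<inter> f)" by blast
  qed (use inj image in auto)
  then show ?thesis by (auto simp: planar_def)
qed

section \<open>Cycles of directed walks\<close>

lemma (in graph) uedges_arc:
  assumes "{x, y} \<in> uedges G"
  obtains a where "a \<in> arcs G" "tail G a = x" "head G a = y"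
proof -
  obtain a where a: "a \<in> arcs G" "{x, y} = {tail G a, head G a}"
    using assms by (auto simp: uedges_def)
  obtain a' where "a' \<in> arcs G" "tail G a' = head G a" "head G a' = tail G a"
    using sym_arcs a(1) by (auto simp: symmetric_conv)
  then show ?thesis using that a by (auto simp: doubleton_eq_iff)
qed

lemma (in graph) uedges_simple: "simple_edges (verts G) (uedges G)"
  using no_loops by (auto simp: simple_edges_def uedges_def card_2_iff)

lemma (in graph) successively_awalk:
  assumes "successively (\<lambda>x y. {x, y} \<in> uedges G) (x # xs)" "x \<in> verts G"
  shows "\<exists>p. awalk x p (last (x # xs)) \<and> awalk_verts x p = x # xs"
  using assms
proof (induction xs arbitrary: x)
  case Nil
  then show ?case by (intro exI[of _ "[]"]) (auto simp: awalk_Nil_iff)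
next
  case (Cons y xs)
  then have xy: "{x, y} \<in> uedges G" by simp
  then obtain a where a: "a \<in> arcs G" "tail G a = x" "head G a = y" by (rule uedges_arc)
  have "y \<in> verts G" using simple_edgesD[OF uedges_simple xy] by simp
  with Cons obtain p where "awalk y p (last (y # xs))" "awalk_verts y p = y # xs" by auto
  then show ?case using a by (intro exI[of _ "a # p"]) (auto simp: awalk_Cons_iff)
qed

lemma (in graph) edge_cycle_graph_cycle:
  assumes "edge_cycle (uedges G) xs"
  shows "\<exists>p. graph_cycle G p \<and> length p = length xs"
proof -
  obtain x ys where xs: "xs = x # ys" using assms by (cases xs) (auto simp: edge_cycle_def)
  have closing: "{last xs, x} \<in> uedges G" using assms xs by (simp add: edge_cycle_def)
  then have "x \<in> verts G" using simple_edgesD[OF uedges_simple] by metis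
  have "ys \<noteq> []" using assms xs by (auto simp: edge_cycle_def)
  then have "successively (\<lambda>x y. {x, y} \<in> uedges G) (x # ys @ [x])"
    using assms xs closing
    by (auto simp: edge_cycle_def edge_path_def successively_append_iff successively_Cons)
  with \<open>x \<in> verts G\<close> obtain p where p: "awalk x p (last (x # ys @ [x]))" "awalk_verts x p = x # ys @ [x]"
    using successively_awalk by metis
  \<comment> \<open>The closed walk lists its start twice and has one arc fewer than listed
    vertices.\<close>
  have len: "length p = length xs" using length_awalk_verts[of x p] p(2) xs by simp
  then have "cycle p" unfolding cycle_def
    using assms p xs by (intro exI[of _ x]) (auto simp: edge_cycle_def edge_path_def)
  then show ?thesis using assms len by (auto simp: graph_cycle_def edge_cycle_def)
qed

text \<open>Without its first entry, the vertex list of a cycle is distinct and has one entry per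
  arc. Finiteness is what makes \<open>Min\<close> and \<open>Max\<close> bound the lengths.\<close>

lemma (in graph) finite_graph_cycle_lengths: "finite {length p |p. graph_cycle G p}"
proof -
  have "length p \<le> card (verts G)" if p: "graph_cycle G p" for p
  proof -
    obtain u where u: "awalk u p u" "distinct (tl (awalk_verts u p))"
      using p by (auto simp: graph_cycle_def cycle_def)
    have "length p = card (set (tl (awalk_verts u p)))"
      using distinct_card[OF u(2)] length_awalk_verts[of u p] by simp
    also have "\<dots> \<le> card (verts G)"
    proof (rule card_mono)
      have "set (awalk_verts u p) \<subseteq> verts G" using u(1) by (rule awalkE)
      then show "set (tl (awalk_verts u p)) \<subseteq> verts G"
        by (meson awalk_verts_non_Nil list.set_sel(2) subset_iff)
    qed simp
    finally show ?thesis .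
  qed
  then have "{length p |p. graph_cycle G p} \<subseteq> {..card (verts G)}" by auto
  then show ?thesis by (rule finite_subset) simp
qed

text \<open>Every cycle length is squeezed between the two invariants. For a graph without cycles
  the claim is vacuous, whatever \<open>Min\<close> and \<open>Max\<close> give on the empty
  set.\<close>

lemma (in graph) girth_eq_circum_imp_equicyclic:
  assumes "girth G = circum G"
  shows "equicyclic (uedges G) (\<lambda>_. 1) (real (girth G))"
  unfolding equicyclic_def
proof (intro allI impI)
  fix xs assume xs: "edge_cycle (uedges G) xs"
  then obtain p where p: "graph_cycle G p" "length p = length xs"
    using edge_cycle_graph_cycle by blast
  have "girth G \<le> length p" "length p \<le> circum G"
    unfolding girth_def circum_def using finite_graph_cycle_lengths p(1)
    by (auto intro: Min_le Max_ge)
  then have "length xs = girth G" using assms p(2) by simp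
  \<comment> \<open>A path has one edge fewer than vertices; the closing edge of a cycle makes up
    for it.\<close>
  moreover have "path_weight (\<lambda>_. 1) ys + 1 = real (length ys)" if "ys \<noteq> []" for ys :: "'a list"
    using that by (induction "\<lambda>_::'a set. 1::real" ys rule: path_weight.induct) auto
  moreover have "xs \<noteq> []" using xs by (auto simp: edge_cycle_def)
  ultimately show "cycle_weight (\<lambda>_. 1) xs = real (girth G)"
    by (simp add: cycle_weight_def)
qed

theorem theorem3p3:
  fixes G :: "('a, 'b) pre_digraph"
  assumes "graph G"
    and "Digraph_Component.connected G"
    and "\<not> planar G"
  shows "girth G \<noteq> circum G"
proof
  assume eq: "girth G = circum G"
  interpret graph G by fact
  have "\<exists>E \<phi>. uedges G \<subseteq> E \<and> straight_drawing (verts G) E \<phi>"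
  proof (cases "2 \<le> card (verts G)")
    case True
    from equicyclic_imp_sub_two_tree[OF this uedges_simple _ girth_eq_circum_imp_equicyclic[OF eq]]
    show ?thesis using two_tree_straight_drawing by (metis zero_less_one)
  next
    \<comment> \<open>With at most one vertex there are no edges, and any placement is a
      drawing.\<close>
    case False
    have "e \<notin> uedges G" for e
      using False uedges_simple card_mono[of "verts G" e] by (auto simp: simple_edges_def)
    then have "uedges G = {}" by auto
    moreover have "inj_on \<phi> (verts G)" for \<phi> :: "'a \<Rightarrow> real ^ 2"
      using False by (auto simp: inj_on_def not_le less_2_cases_iff card_1_singleton_iff)
    ultimately show ?thesis by (auto simp: straight_drawing_def)
  qed
  then show False using straight_drawing_imp_planar \<open>\<not> planar G\<close> by blast
qed

end
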